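(* For all $a,b>0$ with $a\neq b$, the chain of inequalities $L_2<He<A_{2/3}<I<Z_{1/3}<Y_{1/2}$ can be refined as $$L_2(a,b)<P(a,b)<N_{1/2}(a,b)<He(a,b)<A_{2/3}(a,b)<I(a,b)<Z_{1/3}(a,b)<Y_{1/2}(a,b).$$ Moreover, all the constants appearing as subscripts in this refined chain (namely $2$ in $L_2$, $1/2$ in $N_{1/2}$, $2/3$ in $A_{2/3}$, $1/3$ in $Z_{1/3}$ and $1/2$ in $Y_{1/2}$) are the best possible.
   Context: For $a,b>0$ with $a\neq b$ define: the arithmetic mean $A(a,b)=\frac{a+b}{2}$; the geometric mean $G(a,b)=\sqrt{ab}$; the Heronian mean $He(a,b)=\frac{a+b+\sqrt{ab}}{3}$; the logarithmic mean $L(a,b)=\dfrac{a-b}{\ln a-\ln b}$; the identric (exponential) mean $I(a,b)=e^{-1}\left(\dfrac{a^a}{b^b}\right)^{1/(a-b)}$; the first Seiffert mean $P(a,b)=\dfrac{a-b}{2\arcsin\frac{a-b}{a+b}}$; the Neuman-Sándor mean $N(a,b)=\dfrac{a-b}{2\,\mathrm{arcsinh}\frac{a-b}{a+b}}$; the power-exponential mean $Z(a,b)=a^{\frac{a}{a+b}}b^{\frac{b}{a+b}}$; and the exponential-geometric mean $Y(a,b)=I(a,b)\exp\left(1-\dfrac{G(a,b)^2}{L(a,b)^2}\right)$. For $M\in\{A,He,L,I,P,N,Z,Y\}$, the power-type mean of order $p$ is $M_p(a,b)=\left(M(a^p,b^p)\right)^{1/p}$ if $p\neq0$, and $M_0(a,b)=\sqrt{ab}$.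 *)

theory Defs
  imports Complex_Main
begin

text \<open>
  The bivariate means below are only meant for distinct positive arguments; at \<open>a = b\<close> several of
  them degenerate to a division by zero.
\<close>

definition arithmetic_mean :: "real \<Rightarrow> real \<Rightarrow> real" where
  "arithmetic_mean a b = (a + b) / 2"

definition geometric_mean :: "real \<Rightarrow> real \<Rightarrow> real" where
  "geometric_mean a b = sqrt (a * b)"

definition heronian_mean :: "real \<Rightarrow> real \<Rightarrow> real" where
  "heronian_mean a b = (a + b + sqrt (a * b)) / 3"

definition logarithmic_mean :: "real \<Rightarrow> real \<Rightarrow> real" where
  "logarithmic_mean a b = (a - b) / (ln a - ln b)"

definition identric_mean :: "real \<Rightarrow> real \<Rightarrow> real" where
  "identric_mean a b = exp (-1) * ((a powr a) / (b powr b)) powr (1 / (a - b))"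

definition seiffert_mean :: "real \<Rightarrow> real \<Rightarrow> real" where
  "seiffert_mean a b = (a - b) / (2 * arcsin ((a - b) / (a + b)))"

definition neuman_sandor_mean :: "real \<Rightarrow> real \<Rightarrow> real" where
  "neuman_sandor_mean a b = (a - b) / (2 * arsinh ((a - b) / (a + b)))"

definition power_exponential_mean :: "real \<Rightarrow> real \<Rightarrow> real" where
  "power_exponential_mean a b = a powr (a / (a + b)) * b powr (b / (a + b))"

definition exponential_geometric_mean :: "real \<Rightarrow> real \<Rightarrow> real" where
  "exponential_geometric_mean a b =
     identric_mean a b * exp (1 - (geometric_mean a b)\<^sup>2 / (logarithmic_mean a b)\<^sup>2)"

definition power_type :: "(real \<Rightarrow> real \<Rightarrow> real) \<Rightarrow> real \<Rightarrow> real \<Rightarrow> real \<Rightarrow> real" where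
  "power_type M p a b =
     (if p = 0 then sqrt (a * b) else (M (a powr p) (b powr p)) powr (1 / p))"

definition mean_less :: "(real \<Rightarrow> real \<Rightarrow> real) \<Rightarrow> (real \<Rightarrow> real \<Rightarrow> real) \<Rightarrow> bool" where
  "mean_less M M' \<longleftrightarrow> (\<forall>a b. 0 < a \<longrightarrow> 0 < b \<longrightarrow> a \<noteq> b \<longrightarrow> M a b < M' a b)"

text \<open>
  A constant \<open>c\<close> is best possible in a strict inequality between means, valid for all distinct
  positive arguments, if it is the extreme real order for which the inequality holds: the largest
  one if the constant occurs on the smaller side, the smallest one if it occurs on the larger side.
\<close>

definition best_order_on_left ::
    "(real \<Rightarrow> real \<Rightarrow> real) \<Rightarrow> real \<Rightarrow> (real \<Rightarrow> real \<Rightarrow> real) \<Rightarrow> bool" where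
  "best_order_on_left M c M' \<longleftrightarrow>
     mean_less (power_type M c) M' \<and> (\<forall>p. mean_less (power_type M p) M' \<longrightarrow> p \<le> c)"

definition best_order_on_right ::
    "(real \<Rightarrow> real \<Rightarrow> real) \<Rightarrow> (real \<Rightarrow> real \<Rightarrow> real) \<Rightarrow> real \<Rightarrow> bool" where
  "best_order_on_right M' M c \<longleftrightarrow>
     mean_less M' (power_type M c) \<and> (\<forall>p. mean_less M' (power_type M p) \<longrightarrow> c \<le> p)"

end

theory Submission
  imports Defs "HOL-Real_Asymp.Real_Asymp"
begin

text \<open>
  All means in the chain are symmetric and homogeneous, so \<open>a = exp t\<close> and
  \<open>b = exp (- t)\<close> with \<open>t > 0\<close> may be assumed. There the means become
  \<open>L = sinh t / t\<close>, \<open>P = sinh t / arctan (sinh t)\<close>,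
  \<open>N = sinh t / arsinh (tanh t)\<close>, \<open>He = (2 * cosh t + 1) / 3\<close>,
  \<open>A = cosh t\<close>, \<open>I = exp (t * coth t - 1)\<close>,
  \<open>Z = exp (t * tanh t)\<close> and
  \<open>Y = exp (t * coth t - t^2 / sinh^2 t)\<close>, and order \<open>p\<close> replaces a
  function \<open>M t\<close> by \<open>M (p * t) powr (1 / p)\<close>. Seven inequalities in one
  variable remain.

  The first two are instances of the Cauchy-Schwarz inequality
  (\<open>square_less_by_cauchy_schwarz\<close>): the square of the integral of
  \<open>1 / cosh u\<close>, respectively of \<open>1 / sqrt (1 + u^2)\<close>, over
  \<open>[0, x]\<close> is less than \<open>x\<close> times the integral of the square. The
  comparison of \<open>N\<close> with \<open>He\<close> is an algebraic lower bound for
  \<open>arsinh\<close>, and that of \<open>He\<close> with \<open>A\<close> is a polynomial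
  inequality in \<open>cosh (t / 3)\<close>. The last three all come from the single inequality
  \<open>3 * v < 2 * sinh v + tanh v\<close> (\<open>three_times_less\<close>) at
  \<open>v = 2 * t / 3\<close>, or \<open>v = t / 3\<close> in the last one.
  \<open>I < Z\<close> of order 1/3 is equivalent to it. It also gives the positivity of one
  function (\<open>tanh_less_slope\<close>) which, up to positive factors and rescaling of the
  variable, is both the derivative of the logarithm of \<open>I\<close> over \<open>A\<close> of
  order 2/3 and the logarithm of \<open>Y\<close> of order 1/2 over \<open>Z\<close> of
  order 1/3.

  The orders are optimal because of the behaviour near the diagonal. The logarithm of each mean is
  \<open>k * t^2\<close> to leading order, and order \<open>p\<close> multiplies \<open>k\<close> by
  \<open>p\<close> (\<open>curvature_power_type\<close>). With the given orders all members of
  the chain have the same coefficient 1/3, so raising an order on a smaller side or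
  lowering one on a larger side reverses the comparison for small \<open>t\<close>.
\<close>

section \<open>Reduction to one real variable\<close>

text \<open>
  By homogeneity a mean is determined by its values on the branch \<open>(exp t, exp (- t))\<close>
  of the hyperbola \<open>a * b = 1\<close>, where the geometric mean is 1.
\<close>

definition profile :: "(real \<Rightarrow> real \<Rightarrow> real) \<Rightarrow> real \<Rightarrow> real" where
  "profile M t = M (exp t) (exp (- t))"

text \<open>
  Distinct arguments are required throughout because the defining quotients of several means
  degenerate on the diagonal.
\<close>

definition homogeneous_mean :: "(real \<Rightarrow> real \<Rightarrow> real) \<Rightarrow> bool" where
  "homogeneous_mean M \<longleftrightarrow> (\<forall>a b. 0 < a \<longrightarrow> 0 < b \<longrightarrow> a \<noteq> b \<longrightarrow>
     0 < M a b \<and> M b a = M a b \<and> (\<forall>c>0. M (c * a) (c * b) = c * M a b))"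

lemma homogeneous_meanI:
  assumes "\<And>a b. 0 < a \<Longrightarrow> 0 < b \<Longrightarrow> a \<noteq> b \<Longrightarrow> 0 < M a b"
    and "\<And>a b. 0 < a \<Longrightarrow> 0 < b \<Longrightarrow> a \<noteq> b \<Longrightarrow> M b a = M a b"
    and "\<And>a b c. 0 < a \<Longrightarrow> 0 < b \<Longrightarrow> a \<noteq> b \<Longrightarrow> 0 < c \<Longrightarrow> M (c * a) (c * b) = c * M a b"
  shows "homogeneous_mean M"
  using assms by (simp add: homogeneous_mean_def)

lemma homogeneous_meanD:
  assumes "homogeneous_mean M" "0 < a" "0 < b" "a \<noteq> b"
  shows "0 < M a b" "M b a = M a b" "0 < c \<Longrightarrow> M (c * a) (c * b) = c * M a b"
  using assms by (auto simp: homogeneous_mean_def)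

lemma homogeneous_mean_eq_profile:
  assumes "homogeneous_mean M" "0 < a" "0 < b" "a \<noteq> b"
  shows "M a b = sqrt (a * b) * profile M (ln (a / b) / 2)"
proof -
  define t where "t = ln (a / b) / 2"
  have t: "t \<noteq> 0" using assms by (simp add: t_def)
  have a: "sqrt (a * b) * exp t = a" and b: "sqrt (a * b) * exp (- t) = b"
  proof -
    have "exp ((ln a + ln b) / 2) = exp (ln (sqrt (a * b)))"
      using assms by (simp add: ln_sqrt ln_mult)
    hence "sqrt (a * b) = exp ((ln a + ln b) / 2)"
      using assms by simp
    thus "sqrt (a * b) * exp t = a" "sqrt (a * b) * exp (- t) = b"
      using assms by (simp_all add: t_def ln_div field_simps flip: exp_add)
  qed
  have "M (sqrt (a * b) * exp t) (sqrt (a * b) * exp (- t)) = sqrt (a * b) * profile M t"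
    unfolding profile_def using assms t by (intro homogeneous_meanD(3)) auto
  thus ?thesis by (simp only: a b flip: t_def)
qed

text \<open>
  Symmetry allows \<open>b < a\<close>, so that only positive parameters \<open>t\<close> have to be
  compared.
\<close>

lemma mean_lessI:
  assumes M: "homogeneous_mean M" and M': "homogeneous_mean M'"
    and less: "\<And>t. 0 < t \<Longrightarrow> profile M t < profile M' t"
  shows "mean_less M M'"
proof -
  have *: "M a b < M' a b" if "0 < b" "b < a" for a b
    using that M M' less[of "ln (a / b) / 2"] by (simp add: homogeneous_mean_eq_profile)
  have "M a b < M' a b" if "0 < a" "0 < b" "a \<noteq> b" for a b
  proof (cases "b < a")
    case False
    thus ?thesis
      using *[of a b] that homogeneous_meanD(2)[OF M, of b a] homogeneous_meanD(2)[OF M', of b a] by simp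
  qed (use * that in auto)
  thus ?thesis by (simp add: mean_less_def)
qed

lemma homogeneous_mean_power_type:
  assumes M: "homogeneous_mean M"
  shows "homogeneous_mean (power_type M p)"
proof (cases "p = 0")
  case True
  show ?thesis
    by (rule homogeneous_meanI) (auto simp: power_type_def True real_sqrt_mult ac_simps)
next
  case False
  have ne: "a powr p \<noteq> b powr p" if "0 < a" "0 < b" "a \<noteq> b" for a b :: real
    using that False by (metis ln_inj_iff ln_powr mult_left_cancel)
  show ?thesis
  proof (rule homogeneous_meanI)
    fix a b c :: real assume ab: "0 < a" "0 < b" "a \<noteq> b"
    note D = homogeneous_meanD[OF M, of "a powr p" "b powr p"]
    show "0 < power_type M p a b" using D(1) ne ab False by (simp add: power_type_def)
    show "power_type M p b a = power_type M p a b"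
      using D(2) ne ab False by (simp add: power_type_def)
    assume "0 < c"
    thus "power_type M p (c * a) (c * b) = c * power_type M p a b"
      using D(3)[of "c powr p"] ne ab False
      by (simp add: power_type_def powr_mult powr_powr)
  qed
qed

lemma profile_pos: "homogeneous_mean M \<Longrightarrow> t \<noteq> 0 \<Longrightarrow> 0 < profile M t"
  by (simp add: profile_def homogeneous_meanD)

lemma profile_power_type:
  "p \<noteq> 0 \<Longrightarrow> profile (power_type M p) t = profile M (p * t) powr (1 / p)"
  by (simp add: profile_def power_type_def exp_powr_real mult.commute)

section \<open>Behaviour near the diagonal and optimal orders\<close>

text \<open>
  The geometric mean has profile 1, and the logarithm of the profile of a smooth symmetric mean is
  even, so the first term in which two means can differ near the diagonal is the quadratic
  one; \<open>k\<close> is its coefficient.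
\<close>

definition curvature :: "(real \<Rightarrow> real \<Rightarrow> real) \<Rightarrow> real \<Rightarrow> bool" where
  "curvature M k \<longleftrightarrow> ((\<lambda>t. ln (profile M t) / t\<^sup>2) \<longlongrightarrow> k) (at 0)"

text \<open>
  Passing to order \<open>p\<close> replaces the logarithmic profile \<open>m(t)\<close> by
  \<open>m(p t) / p\<close>, which multiplies a quadratic leading term by \<open>p\<close>. The
  relation persists for \<open>p = 0\<close> and for negative orders, so every real order is covered
  at once.
\<close>

lemma curvature_power_type:
  assumes "curvature M k"
  shows "curvature (power_type M p) (p * k)"
proof (cases "p = 0")
  case True
  have "profile (power_type M p) = (\<lambda>t. 1)"
    by (simp add: profile_def power_type_def True fun_eq_iff flip: exp_add)
  thus ?thesis by (simp add: curvature_def True)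
next
  case False
  have "filterlim (\<lambda>t. p * t) (at 0) (at 0)"
    using False by (auto simp: filterlim_at eventually_at_filter intro!: tendsto_eq_intros)
  hence "((\<lambda>t. ln (profile M (p * t)) / (p * t)\<^sup>2) \<longlongrightarrow> k) (at 0)"
    using assms unfolding curvature_def by (rule filterlim_compose[rotated])
  hence "((\<lambda>t. p * (ln (profile M (p * t)) / (p * t)\<^sup>2)) \<longlongrightarrow> p * k) (at 0)"
    by (intro tendsto_intros)
  also have "(\<lambda>t. p * (ln (profile M (p * t)) / (p * t)\<^sup>2)) =
      (\<lambda>t. ln (profile (power_type M p) t) / t\<^sup>2)"
    using False by (auto simp: profile_power_type fun_eq_iff power2_eq_square field_simps)
  finally show ?thesis by (simp add: curvature_def)
qed

lemma curvature_mono: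
  assumes less: "mean_less M M'" and M: "homogeneous_mean M" and M': "homogeneous_mean M'"
    and k: "curvature M k" and k': "curvature M' k'"
  shows "k \<le> k'"
proof -
  have "eventually (\<lambda>t. ln (profile M t) / t\<^sup>2 \<le> ln (profile M' t) / t\<^sup>2) (at 0)"
    unfolding eventually_at_filter
  proof (intro always_eventually allI impI)
    fix t :: real assume t: "t \<noteq> 0"
    hence "profile M t < profile M' t"
      using less by (simp add: mean_less_def profile_def)
    thus "ln (profile M t) / t\<^sup>2 \<le> ln (profile M' t) / t\<^sup>2"
      using profile_pos[OF M t] by (intro divide_right_mono) auto
  qed
  thus ?thesis using k k' unfolding curvature_def by (intro tendsto_le[of "at 0"]) auto
qed

text \<open>
  Equality of the quadratic coefficients at order \<open>c\<close> means that any strictly better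
  order already violates the inequality arbitrarily close to the diagonal.
\<close>

lemma best_order_on_leftI:
  assumes "mean_less (power_type M c) M'" "homogeneous_mean M" "homogeneous_mean M'"
    and "curvature M k" "curvature M' (c * k)" "0 < k"
  shows "best_order_on_left M c M'"
  unfolding best_order_on_left_def
proof (intro conjI allI impI)
  fix p assume "mean_less (power_type M p) M'"
  hence "p * k \<le> c * k"
    by (rule curvature_mono)
      (use assms in \<open>simp_all add: homogeneous_mean_power_type curvature_power_type\<close>)
  thus "p \<le> c" using \<open>0 < k\<close> by simp
qed (rule assms)

lemma best_order_on_rightI:
  assumes "mean_less M' (power_type M c)" "homogeneous_mean M" "homogeneous_mean M'"
    and "curvature M k" "curvature M' (c * k)" "0 < k"
  shows "best_order_on_right M' M c"
  unfolding best_order_on_right_def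
proof (intro conjI allI impI)
  fix p assume "mean_less M' (power_type M p)"
  hence "c * k \<le> p * k"
    by (rule curvature_mono)
      (use assms in \<open>simp_all add: homogeneous_mean_power_type curvature_power_type\<close>)
  thus "c \<le> p" using \<open>0 < k\<close> by simp
qed (rule assms)

section \<open>The eight means and their profiles\<close>

lemma identric_mean_eq:
  assumes "0 < a" "0 < b"
  shows "identric_mean a b = exp ((a * ln a - b * ln b) / (a - b) - 1)"
  using assms by (simp add: identric_mean_def powr_def ln_div exp_diff exp_minus field_simps)

lemma power_exponential_mean_eq:
  assumes "0 < a" "0 < b"
  shows "power_exponential_mean a b = exp ((a * ln a + b * ln b) / (a + b))"
  using assms by (simp add: power_exponential_mean_def powr_def add_divide_distrib flip: exp_add)

lemma homogeneous_arithmetic: "homogeneous_mean arithmetic_mean"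
  by (rule homogeneous_meanI) (auto simp: arithmetic_mean_def algebra_simps add_divide_distrib)

lemma homogeneous_heronian: "homogeneous_mean heronian_mean"
proof (rule homogeneous_meanI)
  fix a b c :: real assume ab: "0 < a" "0 < b" "a \<noteq> b"
  show "0 < heronian_mean a b" using ab by (simp add: heronian_mean_def add_pos_nonneg)
  show "heronian_mean b a = heronian_mean a b" by (simp add: heronian_mean_def ac_simps)
  assume "0 < c"
  thus "heronian_mean (c * a) (c * b) = c * heronian_mean a b"
    by (simp add: heronian_mean_def real_sqrt_mult algebra_simps)
qed

lemma homogeneous_logarithmic: "homogeneous_mean logarithmic_mean"
proof (rule homogeneous_meanI)
  fix a b c :: real assume ab: "0 < a" "0 < b" "a \<noteq> b"
  show "0 < logarithmic_mean a b"
    using ab by (auto simp: logarithmic_mean_def zero_less_divide_iff)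
  show "logarithmic_mean b a = logarithmic_mean a b"
    unfolding logarithmic_mean_def by (metis minus_diff_eq minus_divide_divide)
  assume "0 < c"
  thus "logarithmic_mean (c * a) (c * b) = c * logarithmic_mean a b"
    using ab by (simp add: logarithmic_mean_def ln_mult right_diff_distrib)
qed

lemma homogeneous_identric: "homogeneous_mean identric_mean"
proof (rule homogeneous_meanI)
  fix a b c :: real assume ab: "0 < a" "0 < b" "a \<noteq> b"
  show "0 < identric_mean a b" using ab by (simp add: identric_mean_eq)
  show "identric_mean b a = identric_mean a b"
    using ab by (simp add: identric_mean_eq) (metis minus_diff_eq minus_divide_divide)
  assume c: "0 < c"
  have "(c * a * ln (c * a) - c * b * ln (c * b)) / (c * a - c * b) =
      ln c + (a * ln a - b * ln b) / (a - b)"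
    using ab c by (simp add: ln_mult field_simps)
  thus "identric_mean (c * a) (c * b) = c * identric_mean a b"
    using ab c by (simp add: identric_mean_eq exp_add exp_diff)
qed

lemma homogeneous_seiffert: "homogeneous_mean seiffert_mean"
proof (rule homogeneous_meanI)
  fix a b c :: real assume ab: "0 < a" "0 < b" "a \<noteq> b"
  define x where "x = (a - b) / (a + b)"
  have x: "- 1 < x" "x < 1" using ab by (simp_all add: x_def field_simps)
  have "0 < arcsin x \<longleftrightarrow> 0 < x" "arcsin x < 0 \<longleftrightarrow> x < 0"
    using x arcsin_less_mono[of 0 x] arcsin_less_mono[of x 0] by simp_all
  thus "0 < seiffert_mean a b"
    using ab by (auto simp: seiffert_mean_def x_def zero_less_divide_iff divide_less_0_iff)
  have "(b - a) / (b + a) = - x"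
    by (metis add.commute minus_diff_eq minus_divide_left x_def)
  thus "seiffert_mean b a = seiffert_mean a b"
    using x by (simp add: seiffert_mean_def arcsin_minus flip: x_def)
      (metis minus_diff_eq minus_divide_left)
  assume "0 < c"
  thus "seiffert_mean (c * a) (c * b) = c * seiffert_mean a b"
    by (simp add: seiffert_mean_def flip: right_diff_distrib distrib_left)
qed

lemma homogeneous_neuman_sandor: "homogeneous_mean neuman_sandor_mean"
proof (rule homogeneous_meanI)
  fix a b c :: real assume ab: "0 < a" "0 < b" "a \<noteq> b"
  show "0 < neuman_sandor_mean a b"
    using ab by (auto simp: neuman_sandor_mean_def zero_less_divide_iff divide_less_0_iff)
  define x where "x = (a - b) / (a + b)"
  have "(b - a) / (b + a) = - x"
    by (metis add.commute minus_diff_eq minus_divide_left x_def)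
  thus "neuman_sandor_mean b a = neuman_sandor_mean a b"
    by (simp add: neuman_sandor_mean_def flip: x_def) (metis minus_diff_eq minus_divide_left)
  assume "0 < c"
  thus "neuman_sandor_mean (c * a) (c * b) = c * neuman_sandor_mean a b"
    by (simp add: neuman_sandor_mean_def flip: right_diff_distrib distrib_left)
qed

lemma homogeneous_power_exponential: "homogeneous_mean power_exponential_mean"
proof (rule homogeneous_meanI)
  fix a b c :: real assume ab: "0 < a" "0 < b" "a \<noteq> b"
  show "0 < power_exponential_mean a b" using ab by (simp add: power_exponential_mean_eq)
  show "power_exponential_mean b a = power_exponential_mean a b"
    using ab by (simp add: power_exponential_mean_eq add.commute)
  assume c: "0 < c"
  have "(c * a * ln (c * a) + c * b * ln (c * b)) / (c * a + c * b) =
      ln c + (a * ln a + b * ln b) / (a + b)"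
  proof -
    have "c * a * ln (c * a) + c * b * ln (c * b) =
        c * ((a + b) * ln c + (a * ln a + b * ln b))"
      using ab c by (simp add: ln_mult algebra_simps)
    moreover have "c * a + c * b = c * (a + b)" by (simp add: distrib_left)
    moreover have "a + b \<noteq> 0" using ab by simp
    ultimately show ?thesis using c by (simp add: add_divide_distrib)
  qed
  thus "power_exponential_mean (c * a) (c * b) = c * power_exponential_mean a b"
    using ab c by (simp add: power_exponential_mean_eq exp_add)
qed

lemma homogeneous_exponential_geometric: "homogeneous_mean exponential_geometric_mean"
proof (rule homogeneous_meanI)
  note I = homogeneous_meanD[OF homogeneous_identric]
  note L = homogeneous_meanD[OF homogeneous_logarithmic]
  fix a b c :: real assume ab: "0 < a" "0 < b" "a \<noteq> b"
  show "0 < exponential_geometric_mean a b"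
    using I(1) ab by (simp add: exponential_geometric_mean_def)
  show "exponential_geometric_mean b a = exponential_geometric_mean a b"
    using I(2) L(2) ab
    by (simp add: exponential_geometric_mean_def geometric_mean_def mult.commute)
  assume "0 < c"
  thus "exponential_geometric_mean (c * a) (c * b) = c * exponential_geometric_mean a b"
    using I(3) L(3) ab
    by (simp add: exponential_geometric_mean_def geometric_mean_def real_sqrt_mult power_mult_distrib
        mult_ac power2_eq_square)
qed

lemma exp_diff_exp: "exp t - exp (- t) = 2 * sinh (t::real)"
  and exp_add_exp: "exp t + exp (- t) = 2 * cosh (t::real)"
  by (simp_all add: sinh_field_def cosh_field_def)

lemma profile_arithmetic: "profile arithmetic_mean t = cosh t"
  by (simp add: profile_def arithmetic_mean_def exp_add_exp)

lemma profile_heronian: "profile heronian_mean t = (2 * cosh t + 1) / 3"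
  by (simp add: profile_def heronian_mean_def exp_add_exp flip: exp_add)

lemma profile_logarithmic: "t \<noteq> 0 \<Longrightarrow> profile logarithmic_mean t = sinh t / t"
  by (simp add: profile_def logarithmic_mean_def exp_diff_exp)

lemma arcsin_tanh: "arcsin (tanh t) = arctan (sinh (t::real))"
proof -
  have "sin (arctan (sinh t)) = tanh t"
    using cosh_square_eq[of t] by (simp add: sin_arctan tanh_def add.commute real_sqrt_unique)
  thus ?thesis
    using arcsin_sin[of "arctan (sinh t)"] arctan_bounded[of "sinh t"] by simp
qed

text \<open>
  Rewriting the arcsine of \<open>tanh t\<close> as an arctangent exposes the Gudermannian
  function, whose derivative is the hyperbolic secant.
\<close>

lemma profile_seiffert: "profile seiffert_mean t = sinh t / arctan (sinh t)"
  by (simp add: profile_def seiffert_mean_def exp_diff_exp exp_add_exp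
        arcsin_tanh[unfolded tanh_def])

lemma profile_neuman_sandor: "profile neuman_sandor_mean t = sinh t / arsinh (tanh t)"
  by (simp add: profile_def neuman_sandor_mean_def exp_diff_exp exp_add_exp tanh_def)

lemma exp_mult_ln_diff: "exp t * t - exp (- t) * (- t) = t * (2 * cosh (t::real))"
  by (simp add: algebra_simps cosh_field_def)

lemma profile_identric: "t \<noteq> 0 \<Longrightarrow> profile identric_mean t = exp (t * cosh t / sinh t - 1)"
  using exp_mult_ln_diff[of t] by (simp add: profile_def identric_mean_eq exp_diff_exp)

lemma profile_power_exponential: "profile power_exponential_mean t = exp (t * tanh t)"
proof -
  have "exp t * t + exp (- t) * (- t) = t * (2 * sinh t)"
    by (simp add: algebra_simps sinh_field_def)
  thus ?thesis
    by (simp add: profile_def power_exponential_mean_eq exp_add_exp tanh_def)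
qed

lemma profile_exponential_geometric:
  assumes "t \<noteq> 0"
  shows "profile exponential_geometric_mean t = exp (t * cosh t / sinh t - t\<^sup>2 / (sinh t)\<^sup>2)"
proof -
  have "profile exponential_geometric_mean t =
      profile identric_mean t * exp (1 - 1 / (profile logarithmic_mean t)\<^sup>2)"
    by (simp add: profile_def exponential_geometric_mean_def geometric_mean_def flip: exp_add)
  thus ?thesis
    using assms by (simp add: profile_identric profile_logarithmic power_divide flip: exp_add)
qed

section \<open>Inequalities for hyperbolic functions\<close>

text \<open>
  Positivity is required only inside the interval: the derivatives to which this is applied
  vanish at one of the end points.
\<close>

lemma less_if_deriv_pos:
  fixes f f' :: "real \<Rightarrow> real"
  assumes "a < b" and deriv: "\<And>u. a \<le> u \<Longrightarrow> u \<le> b \<Longrightarrow> (f has_real_derivative f' u) (at u)"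
    and pos: "\<And>u. a < u \<Longrightarrow> u < b \<Longrightarrow> 0 < f' u"
  shows "f a < f b"
proof (rule DERIV_pos_imp_increasing_open[OF \<open>a < b\<close>])
  fix u assume "a < u" "u < b"
  thus "\<exists>D. (f has_real_derivative D) (at u) \<and> 0 < D"
    using deriv[of u] pos[of u] by auto
next
  show "continuous_on {a..b} f"
  proof (intro continuous_at_imp_continuous_on ballI)
    fix u assume "u \<in> {a..b}"
    thus "isCont f u" by (intro DERIV_isCont[OF deriv]) auto
  qed
qed

text \<open>
  This is the Cauchy-Schwarz inequality for \<open>\<phi>\<close> and the constant 1 on
  \<open>[0, x]\<close>, stated through antiderivatives. With \<open>\<phi> z\<close> the average of
  \<open>\<phi>\<close> over the interval, the defect is the integral of
  \<open>(\<phi> u - \<phi> z)^2\<close>, and injectivity makes it strict.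
\<close>

lemma square_less_by_cauchy_schwarz:
  fixes F H \<phi> :: "real \<Rightarrow> real"
  assumes x: "0 < x" and zero: "F 0 = 0" "H 0 = 0"
    and F: "\<And>u. 0 \<le> u \<Longrightarrow> (F has_real_derivative \<phi> u) (at u)"
    and H: "\<And>u. 0 \<le> u \<Longrightarrow> (H has_real_derivative (\<phi> u)\<^sup>2) (at u)"
    and inj: "inj_on \<phi> {0..}"
  shows "(F x)\<^sup>2 < x * H x"
proof -
  obtain z where z: "0 < z" "z < x" and Fx: "F x = x * \<phi> z"
    using MVT2[of 0 x F \<phi>] x F zero by auto
  \<comment> \<open>The derivative of this function is the squared deviation of \<open>\<phi>\<close> from its average.\<close>
  define g where "g u = H u - 2 * \<phi> z * F u + (\<phi> z)\<^sup>2 * u" for u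
  have g: "(g has_real_derivative (\<phi> u - \<phi> z)\<^sup>2) (at u)" if "0 \<le> u" for u
    unfolding g_def using that
    by (auto intro!: derivative_eq_intros F H simp: power2_eq_square algebra_simps)
  have pos: "0 < (\<phi> u - \<phi> z)\<^sup>2" if "0 \<le> u" "u \<noteq> z" for u
    using inj_onD[OF inj, of u z] that z by auto
  have "g 0 < g z" by (rule less_if_deriv_pos[OF z(1) g pos]) auto
  also have "g z < g x" by (rule less_if_deriv_pos[OF z(2) g pos]) (use z in auto)
  finally have "0 < x * g x" using x zero by (simp add: g_def)
  also have "x * g x = x * H x - (F x)\<^sup>2"
    by (simp add: g_def Fx power2_eq_square algebra_simps)
  finally show ?thesis by simp
qed

text \<open>
  A version for functions whose formula has the form 0/0 at 0.
\<close>

lemma limit_less_of_deriv_pos: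
  fixes f :: "real \<Rightarrow> real"
  assumes lim: "(f \<longlongrightarrow> L) (at_right 0)"
    and deriv: "\<And>u. 0 < u \<Longrightarrow> \<exists>D. (f has_real_derivative D) (at u) \<and> 0 < D"
    and u: "0 < u"
  shows "L < f u"
proof -
  have mono: "f v < f w" if "0 < v" "v < w" for v w
    by (rule DERIV_pos_imp_increasing[OF \<open>v < w\<close>]) (use that deriv in auto)
  have "L \<le> f (u / 2)"
  proof (rule tendsto_upperbound[OF lim])
    show "eventually (\<lambda>v. f v \<le> f (u / 2)) (at_right 0)"
      unfolding eventually_at_right_field using mono u
      by (intro exI[of _ "u / 2"]) (auto intro: less_imp_le)
  qed simp
  also have "\<dots> < f u" using mono u by simp
  finally show ?thesis .
qed

lemma one_minus_tanh_square: "1 - (tanh x)\<^sup>2 = 1 / (cosh x)\<^sup>2" for x :: real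
proof -
  have "1 - (tanh x)\<^sup>2 = ((cosh x)\<^sup>2 - (sinh x)\<^sup>2) / (cosh x)\<^sup>2"
    by (simp add: tanh_def power_divide diff_divide_distrib)
  thus ?thesis by (simp add: hyperbolic_pythagoras)
qed

text \<open>
  Cauchy-Schwarz for the hyperbolic secant, whose square is the derivative of
  \<open>tanh\<close>.
\<close>

lemma gudermannian_square_less:
  fixes t :: real
  assumes "0 < t"
  shows "(arctan (sinh t))\<^sup>2 < t * tanh t"
proof (rule square_less_by_cauchy_schwarz[where
      F = "\<lambda>t. arctan (sinh t)" and H = tanh and \<phi> = "\<lambda>u. 1 / cosh u"])
  show "((\<lambda>t. arctan (sinh t)) has_real_derivative 1 / cosh u) (at u)" for u :: real
  proof -
    have "((\<lambda>t. arctan (sinh t)) has_real_derivative inverse (1 + (sinh u)\<^sup>2) * cosh u) (at u)"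
      by (auto intro!: derivative_eq_intros)
    moreover have "1 + (sinh u)\<^sup>2 = cosh u * cosh u"
      using cosh_square_eq[of u] by (simp add: power2_eq_square)
    ultimately show ?thesis by (simp add: inverse_eq_divide)
  qed
  show "(tanh has_real_derivative (1 / cosh u)\<^sup>2) (at u)" for u :: real
    by (auto intro!: derivative_eq_intros simp: one_minus_tanh_square power_divide)
  show "inj_on (\<lambda>u. 1 / cosh u :: real) {0..}"
  proof (rule inj_onI)
    fix u v :: real assume uv: "u \<in> {0..}" "v \<in> {0..}" and eq: "1 / cosh u = 1 / cosh v"
    from eq have "cosh u = cosh v" by (simp only: divide_cancel_left one_neq_zero simp_thms)
    hence "\<bar>u\<bar> = \<bar>v\<bar>" by (simp only: cosh_real_eq_iff)
    with uv show "u = v" by (simp only: atLeast_iff abs_of_nonneg)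
  qed
  show "0 < t" by (rule assms)
  show "arctan (sinh 0) = (0::real)" by simp
qed (rule tanh_0)

text \<open>
  Cauchy-Schwarz again: the square of the derivative of \<open>arsinh\<close> is the derivative of
  \<open>arctan\<close>.
\<close>

lemma arsinh_square_less:
  fixes x :: real
  assumes "0 < x"
  shows "(arsinh x)\<^sup>2 < x * arctan x"
proof (rule square_less_by_cauchy_schwarz[where
      F = arsinh and H = arctan and \<phi> = "\<lambda>u. 1 / sqrt (u\<^sup>2 + 1)"])
  show "(arctan has_real_derivative (1 / sqrt (u\<^sup>2 + 1))\<^sup>2) (at u)" for u :: real
    by (auto intro!: derivative_eq_intros simp: power_divide add.commute inverse_eq_divide)
  show "inj_on (\<lambda>u. 1 / sqrt (u\<^sup>2 + 1) :: real) {0..}"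
    by (auto simp: inj_on_def power2_eq_iff)
qed (use assms in \<open>auto intro!: derivative_eq_intros\<close>)

text \<open>
  Both sides of the unsquared inequality vanish at 0, and comparing derivatives amounts to
  \<open>27 * (1 + u^2) < (3 + u^2)^3\<close>, whose difference is
  \<open>9 * u^4 + u^6\<close>.
\<close>

lemma arsinh_square_greater:
  fixes x :: real
  assumes x: "0 < x"
  shows "3 * x\<^sup>2 < (arsinh x)\<^sup>2 * (3 + x\<^sup>2)"
proof -
  define f where "f u = arsinh u - sqrt 3 * u / sqrt (3 + u\<^sup>2)" for u :: real
  have f': "(f has_real_derivative 1 / sqrt (u\<^sup>2 + 1) - 3 * sqrt 3 / sqrt (3 + u\<^sup>2) ^ 3) (at u)"
    for u
  proof -
    have p: "0 < 3 + u\<^sup>2" by (simp add: add_pos_nonneg)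
    define s where "s = sqrt (3 + u\<^sup>2)"
    have s: "0 < s" "s\<^sup>2 = 3 + u\<^sup>2" using p by (simp_all add: s_def)
    have "((\<lambda>u. sqrt (3 + u\<^sup>2)) has_real_derivative u / s) (at u)"
      using p by (auto intro!: derivative_eq_intros simp: s_def field_simps)
    hence "((\<lambda>u. sqrt 3 * u / sqrt (3 + u\<^sup>2)) has_real_derivative
        (sqrt 3 * s - sqrt 3 * u * (u / s)) / (s * s)) (at u)"
      using s by (auto intro!: derivative_eq_intros simp: s_def inverse_eq_divide)
    moreover have "(sqrt 3 * s - sqrt 3 * u * (u / s)) / (s * s) = 3 * sqrt 3 / s ^ 3"
    proof -
      have "sqrt 3 * s - sqrt 3 * u * (u / s) = sqrt 3 * (s\<^sup>2 - u\<^sup>2) / s"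
        using s(1) by (simp add: field_simps power2_eq_square)
      also have "s\<^sup>2 - u\<^sup>2 = 3" using s by simp
      finally show ?thesis by (simp add: power3_eq_cube mult_ac)
    qed
    ultimately have "((\<lambda>u. sqrt 3 * u / sqrt (3 + u\<^sup>2)) has_real_derivative
        3 * sqrt 3 / s ^ 3) (at u)"
      by (simp only:)
    from DERIV_diff[OF arsinh_real_has_field_derivative this] show ?thesis
      unfolding f_def s_def .
  qed
  have pos: "0 < 1 / sqrt (u\<^sup>2 + 1) - 3 * sqrt 3 / sqrt (3 + u\<^sup>2) ^ 3" if u: "0 < u" for u :: real
  proof -
    have p: "0 < 3 + u\<^sup>2" "0 < u\<^sup>2 + 1" by (simp_all add: add_pos_nonneg add_nonneg_pos)
    have "(3 * sqrt 3 * sqrt (u\<^sup>2 + 1))\<^sup>2 = 27 * (u\<^sup>2 + 1)"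
      by (simp add: power_mult_distrib)
    also have "\<dots> < (3 + u\<^sup>2) ^ 3"
      using u by (simp add: power3_eq_cube algebra_simps add_pos_pos)
    also have "\<dots> = ((sqrt (3 + u\<^sup>2))\<^sup>2) ^ 3" using p by simp
    also have "\<dots> = (sqrt (3 + u\<^sup>2) ^ 3)\<^sup>2"
      by (simp only: mult.commute flip: power_mult)
    finally have "3 * sqrt 3 * sqrt (u\<^sup>2 + 1) < sqrt (3 + u\<^sup>2) ^ 3"
      by (rule power2_less_imp_less) (use p in simp)
    thus ?thesis using p by (simp add: divide_simps)
  qed
  have "f 0 < f x"
    by (rule less_if_deriv_pos[OF x f' pos])
  hence "sqrt 3 * x / sqrt (3 + x\<^sup>2) < arsinh x" by (simp add: f_def)
  hence "(sqrt 3 * x / sqrt (3 + x\<^sup>2))\<^sup>2 < (arsinh x)\<^sup>2"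
    using x by (intro power_strict_mono) auto
  moreover have "0 < 3 + x\<^sup>2" by (simp add: add_pos_nonneg)
  ultimately show ?thesis
    by (simp add: power_divide power_mult_distrib divide_less_eq)
qed

text \<open>
  The hyperbolic Huygens inequality. The derivative of the difference of the two sides is
  nonnegative by the arithmetic-geometric mean inequality applied to \<open>cosh v\<close>,
  \<open>cosh v\<close> and \<open>1 / (cosh v)^2\<close>. The last three inequalities of the chain
  all rest on this one.
\<close>

lemma three_times_less:
  fixes v :: real
  assumes v: "0 < v"
  shows "3 * v < 2 * sinh v + tanh v"
proof -
  define f where "f v = 2 * sinh v + tanh v - 3 * v" for v :: real
  have f': "(f has_real_derivative 2 * cosh v + 1 / (cosh v)\<^sup>2 - 3) (at v)" for v
    unfolding f_def by (auto intro!: derivative_eq_intros simp: one_minus_tanh_square)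
  have pos: "0 < 2 * cosh v + 1 / (cosh v)\<^sup>2 - 3" if "0 < v" for v :: real
  proof -
    have c: "1 < cosh v" using cosh_real_nonneg_less_iff[of 0 v] that by simp
    \<comment> \<open>The factored form of \<open>2 * c^3 - 3 * c^2 + 1\<close> at \<open>c = cosh v\<close>.\<close>
    hence "0 < (cosh v - 1)\<^sup>2 * (2 * cosh v + 1) / (cosh v)\<^sup>2"
      by (intro divide_pos_pos mult_pos_pos zero_less_power) auto
    also have "\<dots> = 2 * cosh v + 1 / (cosh v)\<^sup>2 - 3"
      using c by (simp add: field_simps power2_eq_square)
    finally show ?thesis .
  qed
  have "f 0 < f v"
    by (rule less_if_deriv_pos[OF v f' pos])
  thus ?thesis by (simp add: f_def)
qed

lemma three_times_cosh_less:
  fixes u :: real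
  assumes u: "0 < u"
  shows "3 * u * cosh (2 * u) < sinh (3 * u) * cosh u"
proof -
  have "3 * (2 * u) * cosh (2 * u) < (2 * sinh (2 * u) + tanh (2 * u)) * cosh (2 * u)"
    using three_times_less[of "2 * u"] u by (intro mult_strict_right_mono) auto
  also have "\<dots> = 2 * sinh (2 * u) * cosh (2 * u) + sinh (2 * u)"
    by (simp add: tanh_def distrib_right)
  also have "\<dots> = 2 * (sinh (3 * u) * cosh u)"
  proof -
    have sinh_3: "sinh (3 * u) = sinh (2 * u) * cosh u + cosh (2 * u) * sinh u"
      using sinh_add[of "2 * u" u] by simp
    show ?thesis
      unfolding sinh_3 sinh_double cosh_double_cosh by (simp add: power2_eq_square algebra_simps)
  qed
  finally show ?thesis by (simp add: mult_ac)
qed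

text \<open>
  Up to positive factors, the difference of the two sides is the logarithmic ratio of
  \<open>Y\<close> of order 1/2 and \<open>Z\<close> of order 1/3; it is also the
  derivative that compares \<open>I\<close> with \<open>A\<close> of order 2/3.
\<close>

lemma tanh_less_slope:
  fixes u :: real
  assumes u: "0 < u"
  shows "tanh (2 * u) < cosh (3 * u) / sinh (3 * u) - 3 * u / (sinh (3 * u))\<^sup>2"
proof -
  have "3 * u * cosh (2 * u) <
      sinh (3 * u) * (cosh (3 * u) * cosh (2 * u) - sinh (3 * u) * sinh (2 * u))"
    using three_times_cosh_less[OF u] cosh_diff[of "3 * u" "2 * u"] by simp
  moreover have "0 < sinh (3 * u)" using u by simp
  ultimately show ?thesis
    by (simp add: tanh_def field_simps power2_eq_square)
qed

section \<open>The chain of inequalities\<close>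

text \<open>
  Along the hyperbola the claim is \<open>g^2 < t * tanh t\<close> for the Gudermannian
  \<open>g\<close> of \<open>t\<close>.
\<close>

lemma logarithmic_2_less_seiffert:
  "mean_less (power_type logarithmic_mean 2) seiffert_mean"
proof (rule mean_lessI)
  fix t :: real assume t: "0 < t"
  define g where "g = arctan (sinh t)"
  have pos: "0 < g" "0 < sinh t" "0 < cosh t" using t by (simp_all add: g_def)
  have "g\<^sup>2 * cosh t < t * sinh t"
    using gudermannian_square_less[OF t] by (simp add: g_def tanh_def field_simps)
  hence "sinh t * cosh t / t < (sinh t / g)\<^sup>2"
    using t pos by (simp add: power_divide power2_eq_square field_simps)
  hence "sinh (2 * t) / (2 * t) < (sinh t / g)\<^sup>2"
    by (simp add: sinh_double)
  hence "sqrt (sinh (2 * t) / (2 * t)) < sinh t / g"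
    using pos t by (intro real_less_lsqrt) auto
  thus "profile (power_type logarithmic_mean 2) t < profile seiffert_mean t"
    using t by (simp add: profile_power_type profile_logarithmic profile_seiffert g_def
        powr_half_sqrt)
qed (simp_all add: homogeneous_mean_power_type homogeneous_logarithmic homogeneous_seiffert)

lemma profile_neuman_sandor_half:
  assumes "0 < s"
  shows "profile (power_type neuman_sandor_mean (1/2)) (2 * s) = (sinh s / arsinh (tanh s))\<^sup>2"
proof -
  have "0 < sinh s / arsinh (tanh s)" using assms by simp
  hence "(sinh s / arsinh (tanh s)) powr 2 = (sinh s / arsinh (tanh s))\<^sup>2"
    by (rule powr_numeral[OF less_imp_le])
  thus ?thesis by (simp add: profile_power_type profile_neuman_sandor)
qed

text \<open>
  With \<open>x = tanh (t / 2)\<close> the Gudermannian of \<open>t\<close> is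
  \<open>2 * arctan x\<close>, which turns the claim into
  \<open>(arsinh x)^2 < x * arctan x\<close>.
\<close>

lemma seiffert_less_neuman_sandor_half:
  "mean_less seiffert_mean (power_type neuman_sandor_mean (1/2))"
proof (rule mean_lessI)
  fix t :: real assume t: "0 < t"
  define s where "s = t / 2"
  have s: "0 < s" "t = 2 * s" using t by (simp_all add: s_def)
  define a b where "a = arsinh (tanh s)" and "b = arctan (tanh s)"
  have pos: "0 < a" "0 < b" "0 < sinh s" "0 < cosh s" using s by (simp_all add: a_def b_def)
  have "2 * tanh s / (1 - (tanh s)\<^sup>2) = sinh (2 * s)"
    using pos unfolding one_minus_tanh_square sinh_double by (simp add: tanh_def power2_eq_square)
  hence "arctan (sinh (2 * s)) = 2 * b"
    using arctan_double[of "tanh s"] tanh_real_bounds[of s] by (simp add: b_def abs_less_iff)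
  moreover have "a\<^sup>2 * cosh s < sinh s * b"
    using arsinh_square_less[of "tanh s"] s pos by (simp add: a_def b_def tanh_def field_simps)
  moreover from this have "sinh s * cosh s / b < (sinh s / a)\<^sup>2"
    using pos by (simp add: power_divide power2_eq_square field_simps)
  ultimately have "sinh (2 * s) / arctan (sinh (2 * s)) < (sinh s / a)\<^sup>2"
    by (simp add: sinh_double)
  thus "profile seiffert_mean t < profile (power_type neuman_sandor_mean (1/2)) t"
    using s by (simp add: profile_seiffert profile_neuman_sandor_half a_def)
qed (simp_all add: homogeneous_mean_power_type homogeneous_neuman_sandor homogeneous_seiffert)

lemma neuman_sandor_half_less_heronian:
  "mean_less (power_type neuman_sandor_mean (1/2)) heronian_mean"
proof (rule mean_lessI)
  fix t :: real assume t: "0 < t"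
  define s where "s = t / 2"
  have s: "0 < s" "t = 2 * s" using t by (simp_all add: s_def)
  define a where "a = arsinh (tanh s)"
  have pos: "0 < a" "0 < sinh s" "0 < cosh s" using s by (simp_all add: a_def)
  have T: "(tanh s)\<^sup>2 * (cosh s)\<^sup>2 = (sinh s)\<^sup>2" by (simp add: tanh_def power_divide)
  have "3 * (tanh s)\<^sup>2 * (cosh s)\<^sup>2 < a\<^sup>2 * (3 + (tanh s)\<^sup>2) * (cosh s)\<^sup>2"
    using arsinh_square_greater[of "tanh s"] s by (simp add: a_def)
  also have "\<dots> = a\<^sup>2 * (3 * (cosh s)\<^sup>2 + (tanh s)\<^sup>2 * (cosh s)\<^sup>2)"
    by (simp add: algebra_simps)
  finally have "3 * (sinh s)\<^sup>2 < a\<^sup>2 * (3 * (cosh s)\<^sup>2 + (sinh s)\<^sup>2)"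
    by (simp only: T mult.assoc)
  hence "(sinh s / a)\<^sup>2 < (4 * (sinh s)\<^sup>2 + 3) / 3"
    using pos by (simp add: cosh_square_eq power_divide field_simps)
  also have "\<dots> = (2 * cosh (2 * s) + 1) / 3"
    by (simp add: cosh_double cosh_square_eq)
  finally have "(sinh s / a)\<^sup>2 < (2 * cosh (2 * s) + 1) / 3" .
  thus "profile (power_type neuman_sandor_mean (1/2)) t < profile heronian_mean t"
    using s by (simp add: profile_heronian profile_neuman_sandor_half a_def)
qed (simp_all add: homogeneous_mean_power_type homogeneous_neuman_sandor homogeneous_heronian)

text \<open>
  In terms of \<open>c = cosh (t / 3)\<close> both sides are algebraic, and squaring leaves a
  polynomial inequality with a double root at \<open>c = 1\<close>, the diagonal.
\<close>

lemma heronian_less_arithmetic_two_thirds: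
  "mean_less heronian_mean (power_type arithmetic_mean (2/3))"
proof (rule mean_lessI)
  fix t :: real assume t: "0 < t"
  define u where "u = t / 3"
  have u: "0 < u" "t = 3 * u" using t by (simp_all add: u_def)
  define c where "c = cosh u"
  have c: "1 < c" using cosh_real_nonneg_less_iff[of 0 u] u by (simp add: c_def)
  have c3: "cosh (3 * u) = 4 * c ^ 3 - 3 * c"
  proof -
    have "cosh (3 * u) = (2 * c\<^sup>2 - 1) * c + 2 * (sinh u)\<^sup>2 * c"
      using cosh_add[of "2 * u" u] by (simp add: c_def sinh_double cosh_double_cosh power2_eq_square)
    also have "(sinh u)\<^sup>2 = c\<^sup>2 - 1" by (simp add: c_def sinh_square_eq)
    finally show ?thesis by (simp add: power2_eq_square power3_eq_cube algebra_simps)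
  qed
  have c2: "cosh (2 * u) = 2 * c\<^sup>2 - 1" by (simp add: cosh_double_cosh c_def)
  have "0 < (c - 1)\<^sup>2 * (4 * c ^ 4 + 8 * c ^ 3 + 6 * c\<^sup>2 - 4 * c - 5)"
  proof (rule mult_pos_pos)
    have "1 < c ^ 4" "c < c\<^sup>2" using c by (simp_all add: power2_eq_square)
    moreover have "0 < c ^ 3" using c by simp
    ultimately show "0 < 4 * c ^ 4 + 8 * c ^ 3 + 6 * c\<^sup>2 - 4 * c - 5"
      using c one_less_power[OF c, of 3] by linarith
  qed (use c in simp)
  also have "\<dots> = 9 / 2 * ((2 * c\<^sup>2 - 1) ^ 3 - ((2 * (4 * c ^ 3 - 3 * c) + 1) / 3)\<^sup>2)"
    by (simp add: power2_eq_square power3_eq_cube power4_eq_xxxx field_simps)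
  finally have "((2 * cosh (3 * u) + 1) / 3)\<^sup>2 < cosh (2 * u) ^ 3"
    by (simp add: c3 c2)
  hence "(2 * cosh (3 * u) + 1) / 3 < sqrt (cosh (2 * u) ^ 3)"
    by (rule real_less_rsqrt)
  also have "\<dots> = cosh (2 * u) powr (3 / 2)"
    by (simp add: powr_powr flip: powr_half_sqrt powr_numeral)
  finally show "profile heronian_mean t < profile (power_type arithmetic_mean (2/3)) t"
    using u by (simp add: profile_heronian profile_power_type profile_arithmetic)
qed (simp_all add: homogeneous_mean_power_type homogeneous_arithmetic homogeneous_heronian)

text \<open>
  The two logarithmic profiles agree in the limit \<open>t = 0\<close>, and the derivative of their
  difference is positive by \<open>tanh_less_slope\<close>.
\<close>

lemma arithmetic_two_thirds_less_identric:
  "mean_less (power_type arithmetic_mean (2/3)) identric_mean"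
proof (rule mean_lessI)
  fix t :: real assume t: "0 < t"
  define f where "f u = 3 * u * cosh (3 * u) / sinh (3 * u) - 3 / 2 * ln (cosh (2 * u))" for u :: real
  have "1 < f (t / 3)"
  proof (rule limit_less_of_deriv_pos[where f = f])
    show "(f \<longlongrightarrow> 1) (at_right 0)" unfolding f_def by real_asymp
    fix u :: real assume u: "0 < u"
    have "(f has_real_derivative
        3 * (cosh (3 * u) / sinh (3 * u) - 3 * u / (sinh (3 * u))\<^sup>2 - tanh (2 * u))) (at u)"
      using u cosh_square_eq[of "3 * u"] unfolding f_def
      by (auto intro!: derivative_eq_intros simp: tanh_def field_simps power2_eq_square)
    thus "\<exists>D. (f has_real_derivative D) (at u) \<and> 0 < D"
      using tanh_less_slope[OF u] by fastforce
  qed (use t in simp)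
  also have "f (t / 3) = t * cosh t / sinh t - 3 / 2 * ln (cosh (2 * t / 3))"
    by (simp add: f_def)
  finally have "3 / 2 * ln (cosh (2 * t / 3)) < t * cosh t / sinh t - 1" by linarith
  hence "exp (3 / 2 * ln (cosh (2 * t / 3))) < exp (t * cosh t / sinh t - 1)"
    by (simp only: exp_less_mono)
  thus "profile (power_type arithmetic_mean (2/3)) t < profile identric_mean t"
    using t by (simp add: profile_power_type profile_arithmetic profile_identric powr_def)
qed (simp_all add: homogeneous_mean_power_type homogeneous_arithmetic homogeneous_identric)

lemma profile_power_exponential_power_type:
  "p \<noteq> 0 \<Longrightarrow> profile (power_type power_exponential_mean p) t = exp (t * tanh (p * t))"
  by (simp add: profile_power_type profile_power_exponential exp_powr_real)

lemma identric_less_power_exponential_third: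
  "mean_less identric_mean (power_type power_exponential_mean (1/3))"
proof (rule mean_lessI)
  fix t :: real assume t: "0 < t"
  define u where "u = t / 3"
  have u: "0 < u" "t = 3 * u" using t by (simp_all add: u_def)
  have "3 * u * (cosh (3 * u) * cosh u - sinh (3 * u) * sinh u) < sinh (3 * u) * cosh u"
    using three_times_cosh_less[OF u(1)] cosh_diff[of "3 * u" u] by simp
  moreover have "0 < sinh (3 * u)" using u by simp
  ultimately have "3 * u * cosh (3 * u) / sinh (3 * u) - 1 < 3 * u * tanh u"
    by (simp add: tanh_def field_simps)
  thus "profile identric_mean t < profile (power_type power_exponential_mean (1/3)) t"
    using u by (simp add: profile_identric profile_power_exponential_power_type)
qed (simp_all add: homogeneous_mean_power_type homogeneous_power_exponential homogeneous_identric)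

lemma power_exponential_third_less_exponential_geometric_half:
  "mean_less (power_type power_exponential_mean (1/3)) (power_type exponential_geometric_mean (1/2))"
proof (rule mean_lessI)
  fix t :: real assume t: "0 < t"
  define s where "s = t / 2"
  have s: "0 < s" "t = 2 * s" using t by (simp_all add: s_def)
  have "2 * s * tanh (2 * s / 3) < 2 * s * (cosh s / sinh s - s / (sinh s)\<^sup>2)"
    using tanh_less_slope[of "s / 3"] s by (intro mult_strict_left_mono) auto
  also have "\<dots> = (s * cosh s / sinh s - s\<^sup>2 / (sinh s)\<^sup>2) * 2"
    by (simp add: power2_eq_square algebra_simps)
  finally show "profile (power_type power_exponential_mean (1/3)) t
      < profile (power_type exponential_geometric_mean (1/2)) t"
    using s by (simp add: profile_power_exponential_power_type profile_power_type[of "1/2"]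
        profile_exponential_geometric exp_powr_real)
qed (simp_all add: homogeneous_mean_power_type homogeneous_power_exponential
      homogeneous_exponential_geometric)

section \<open>Quadratic coefficients of the means\<close>

lemma curvatureI:
  assumes "((\<lambda>t. f t / t\<^sup>2) \<longlongrightarrow> k) (at 0)" "\<And>t. t \<noteq> 0 \<Longrightarrow> ln (profile M t) = f t"
  shows "curvature M k"
proof -
  have "eventually (\<lambda>t. f t / t\<^sup>2 = ln (profile M t) / t\<^sup>2) (at 0)"
    using assms(2) by (auto simp: eventually_at_filter)
  thus ?thesis
    using assms(1) unfolding curvature_def by (rule Lim_transform_eventually[rotated])
qed

lemma curvature_logarithmic: "curvature logarithmic_mean (1/6)"
  by (rule curvatureI[where f = "\<lambda>t. ln (sinh t / t)"])
     (real_asymp, simp add: profile_logarithmic)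

lemma curvature_seiffert: "curvature seiffert_mean (1/3)"
  unfolding curvature_def profile_seiffert by real_asymp

lemma curvature_heronian: "curvature heronian_mean (1/3)"
  unfolding curvature_def profile_heronian by real_asymp

lemma curvature_arithmetic: "curvature arithmetic_mean (1/2)"
  unfolding curvature_def profile_arithmetic by real_asymp

text \<open>
  The profile is factored as \<open>cosh t\<close> divided by the ratio of \<open>arsinh x\<close> to
  \<open>x\<close> at \<open>x = tanh t\<close>, so that the expansion of the composite
  function reduces to expansions of the two factors.
\<close>

lemma curvature_neuman_sandor: "curvature neuman_sandor_mean (2/3)"
proof (rule curvatureI[where f = "\<lambda>t. ln (cosh t) - ln (arsinh (tanh t) / tanh t)"])
  have "((\<lambda>x::real. ln (arsinh x / x) / x\<^sup>2) \<longlongrightarrow> - 1 / 6) (at 0)"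
    by (real_asymp simp: arsinh_real_def)
  moreover have "filterlim (tanh :: real \<Rightarrow> real) (at 0) (at 0)"
    by (auto simp: filterlim_at eventually_at_filter intro!: tendsto_eq_intros)
  ultimately have "((\<lambda>t::real. ln (arsinh (tanh t) / tanh t) / (tanh t)\<^sup>2) \<longlongrightarrow> - 1 / 6) (at 0)"
    by (rule filterlim_compose)
  moreover have "((\<lambda>t::real. tanh t / t) \<longlongrightarrow> 1) (at 0)"
    by (real_asymp simp: tanh_def)
  moreover have "((\<lambda>t::real. ln (cosh t) / t\<^sup>2) \<longlongrightarrow> 1 / 2) (at 0)"
    by real_asymp
  ultimately have "((\<lambda>t::real. ln (cosh t) / t\<^sup>2 -
      ln (arsinh (tanh t) / tanh t) / (tanh t)\<^sup>2 * (tanh t / t)\<^sup>2)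
      \<longlongrightarrow> 1 / 2 - (- 1 / 6) * 1\<^sup>2) (at 0)"
    by (intro tendsto_diff tendsto_mult tendsto_power)
  also have "(\<lambda>t::real. ln (cosh t) / t\<^sup>2 -
      ln (arsinh (tanh t) / tanh t) / (tanh t)\<^sup>2 * (tanh t / t)\<^sup>2) =
      (\<lambda>t. (ln (cosh t) - ln (arsinh (tanh t) / tanh t)) / t\<^sup>2)"
    by (auto simp: fun_eq_iff power_divide diff_divide_distrib)
  finally show "((\<lambda>t::real. (ln (cosh t) - ln (arsinh (tanh t) / tanh t)) / t\<^sup>2)
      \<longlongrightarrow> 2 / 3) (at 0)" by simp
next
  fix t :: real assume "t \<noteq> 0"
  moreover have "ln (tanh t) = ln (sinh t) - ln (cosh t)" if "t \<noteq> 0"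
    using that by (simp add: tanh_def ln_div)
  ultimately show "ln (profile neuman_sandor_mean t) =
      ln (cosh t) - ln (arsinh (tanh t) / tanh t)"
    by (simp add: profile_neuman_sandor ln_div)
qed

lemma curvature_identric: "curvature identric_mean (1/3)"
  by (rule curvatureI[where f = "\<lambda>t. t * cosh t / sinh t - 1"])
     (real_asymp, simp add: profile_identric)

lemma curvature_power_exponential: "curvature power_exponential_mean 1"
  unfolding curvature_def profile_power_exponential ln_exp by (real_asymp simp: tanh_def)

lemma curvature_exponential_geometric: "curvature exponential_geometric_mean (2/3)"
  by (rule curvatureI[where f = "\<lambda>t. t * cosh t / sinh t - t\<^sup>2 / (sinh t)\<^sup>2"])
     (real_asymp, simp add: profile_exponential_geometric)

lemmas homogeneous_means =
  homogeneous_mean_power_type homogeneous_arithmetic homogeneous_heronian homogeneous_logarithmic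
  homogeneous_identric homogeneous_seiffert homogeneous_neuman_sandor
  homogeneous_power_exponential homogeneous_exponential_geometric

lemmas chain =
  logarithmic_2_less_seiffert seiffert_less_neuman_sandor_half neuman_sandor_half_less_heronian
  heronian_less_arithmetic_two_thirds arithmetic_two_thirds_less_identric
  identric_less_power_exponential_third power_exponential_third_less_exponential_geometric_half

theorem mainTheorem8:
  shows "(\<forall>a b :: real. 0 < a \<longrightarrow> 0 < b \<longrightarrow> a \<noteq> b \<longrightarrow>
            power_type logarithmic_mean 2 a b < seiffert_mean a b \<and>
            seiffert_mean a b < power_type neuman_sandor_mean (1/2) a b \<and>
            power_type neuman_sandor_mean (1/2) a b < heronian_mean a b \<and>
            heronian_mean a b < power_type arithmetic_mean (2/3) a b \<and>
            power_type arithmetic_mean (2/3) a b < identric_mean a b \<and>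
            identric_mean a b < power_type power_exponential_mean (1/3) a b \<and>
            power_type power_exponential_mean (1/3) a b
              < power_type exponential_geometric_mean (1/2) a b)
       \<and> best_order_on_left logarithmic_mean 2 seiffert_mean
       \<and> best_order_on_right seiffert_mean neuman_sandor_mean (1/2)
       \<and> best_order_on_left neuman_sandor_mean (1/2) heronian_mean
       \<and> best_order_on_right heronian_mean arithmetic_mean (2/3)
       \<and> best_order_on_left arithmetic_mean (2/3) identric_mean
       \<and> best_order_on_right identric_mean power_exponential_mean (1/3)
       \<and> best_order_on_left power_exponential_mean (1/3)
           (power_type exponential_geometric_mean (1/2))
       \<and> best_order_on_right (power_type power_exponential_mean (1/3))
           exponential_geometric_mean (1/2)"
proof (intro conjI)
  show "best_order_on_left logarithmic_mean 2 seiffert_mean"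
    using curvature_seiffert
    by (intro best_order_on_leftI[OF _ _ _ curvature_logarithmic])
      (simp_all add: chain homogeneous_means)
  show "best_order_on_right seiffert_mean neuman_sandor_mean (1/2)"
    using curvature_seiffert
    by (intro best_order_on_rightI[OF _ _ _ curvature_neuman_sandor])
      (simp_all add: chain homogeneous_means)
  show "best_order_on_left neuman_sandor_mean (1/2) heronian_mean"
    using curvature_heronian
    by (intro best_order_on_leftI[OF _ _ _ curvature_neuman_sandor])
      (simp_all add: chain homogeneous_means)
  show "best_order_on_right heronian_mean arithmetic_mean (2/3)"
    using curvature_heronian
    by (intro best_order_on_rightI[OF _ _ _ curvature_arithmetic])
      (simp_all add: chain homogeneous_means)
  show "best_order_on_left arithmetic_mean (2/3) identric_mean"
    using curvature_identric
    by (intro best_order_on_leftI[OF _ _ _ curvature_arithmetic])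
      (simp_all add: chain homogeneous_means)
  show "best_order_on_right identric_mean power_exponential_mean (1/3)"
    using curvature_identric
    by (intro best_order_on_rightI[OF _ _ _ curvature_power_exponential])
      (simp_all add: chain homogeneous_means)
  show "best_order_on_left power_exponential_mean (1/3) (power_type exponential_geometric_mean (1/2))"
    using curvature_power_type[OF curvature_exponential_geometric, of "1/2"]
    by (intro best_order_on_leftI[OF _ _ _ curvature_power_exponential])
      (simp_all add: chain homogeneous_means)
  show "best_order_on_right (power_type power_exponential_mean (1/3)) exponential_geometric_mean (1/2)"
    using curvature_power_type[OF curvature_power_exponential, of "1/3"]
    by (intro best_order_on_rightI[OF _ _ _ curvature_exponential_geometric])
       (simp_all add: chain homogeneous_means)
qed (use chain in \<open>simp add: mean_less_def\<close>)

end
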